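(* Let $M$ be a positive integer with $\frac{N}{2}<M\le N$, and let $0<\beta<\alpha$ be such that $2\beta+\alpha<\pi$ and $$\frac{M}{N}\sin\Big(\frac{\alpha}{2}-\frac{\beta}{4}\Big)\cos\Big(\frac{\alpha}{2}+\frac{5}{8}\beta\Big)-\Big(1-\frac{M}{N}\Big)\cos\Big(\frac{\alpha}{2}-\frac{\beta}{8}\Big)>0.$$ Let $\mu$ and $\lambda$ be real numbers such that $$0<\mu\le\frac{M}{N}\sin\Big(\frac{\alpha}{2}-\frac{\beta}{4}\Big)\cos\Big(\frac{\alpha}{2}+\frac{5}{8}\beta\Big)-\Big(1-\frac{M}{N}\Big)\cos\Big(\frac{\alpha}{2}-\frac{\beta}{8}\Big)$$ and $\lambda>\mu+2$. Assume that $$mK\le\frac{\beta}{4(\lambda+\mu+2)\ln\big(\frac{\lambda+2\mu+2}{\mu}\big)}\qquad\text{and}\qquad D(\Omega)<\mu K.$$ Then the solution $\Theta(t)=(\theta_1(t),\dots,\theta_N(t))$, $t\ge0$, of $$m\ddot\theta_i+\dot\theta_i=\omega_i+\frac{K}{N}\sum_{j=1}^N\sin(\theta_j-\theta_i),\qquad t>0,\ i=1,\dots,N,$$ with initial conditions satisfying $$D(\Theta_M(0))\le\pi-\alpha-\beta\qquad\text{and}\qquad D(\dot\Theta_M(0))<\lambda K$$ achieves the complete frequency synchronization asymptotically, i.e. $$\lim_{t\to\infty}\dot\theta_i(t)=\omega\quad\text{for all }1\le i\le N.$$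
   Context: $N$ is a positive integer (the number of oscillators), $m>0$ is the inertia, $K>0$ is the coupling strength, and $\Omega=(\omega_1,\dots,\omega_N)\in\mathbb{R}^N$ is the constant vector of natural frequencies, with mean $\omega:=\frac1N\sum_{i=1}^N\omega_i$. The phases $\theta_i(t)$ are real-valued (not reduced modulo $2\pi$). For a positive integer $M\le N$, $\Theta_M(t):=(\theta_1(t),\dots,\theta_M(t))$ denotes the vector of the first $M$ components of $\Theta(t)$, and $\dot\Theta_M(t)=(\dot\theta_1(t),\dots,\dot\theta_M(t))$. For a finite-dimensional vector $X=(x_1,\dots,x_n)$, $D(X):=\max_{1\le i,j\le n}(x_i-x_j)$. *)

theory Defs
  imports "HOL-Analysis.Analysis"
begin

text \<open>A vector \<open>(x\<^sub>1, \<dots>, x\<^sub>n)\<close> is a function \<open>x :: nat \<Rightarrow> real\<close> of which only the values at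
  \<open>1, \<dots>, n\<close> matter.  Hence \<open>vec_diam M x\<close> with \<open>M \<le> n\<close> is the diameter of the first \<open>M\<close>
  components of \<open>x\<close>.  The value for \<open>n = 0\<close> is unspecified.\<close>

definition vec_diam :: "nat \<Rightarrow> (nat \<Rightarrow> real) \<Rightarrow> real" where
  "vec_diam n x = Max ((\<lambda>(i, j). x i - x j) ` ({1..n} \<times> {1..n}))"

definition vec_mean :: "nat \<Rightarrow> (nat \<Rightarrow> real) \<Rightarrow> real" where
  "vec_mean n x = (1 / real n) * (\<Sum>i = 1..n. x i)"

text \<open>\<open>\<Theta> t i\<close> is the \<open>i\<close>-th phase at time \<open>t\<close> and \<open>\<Theta>' t i\<close> its time derivative, which is
  one-sided at \<open>t = 0\<close>.  A solution is continuously differentiable on \<open>[0, \<infinity>)\<close> and satisfies the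
  second-order equation on \<open>(0, \<infinity>)\<close>.\<close>

definition inertial_kuramoto_solution ::
  "nat \<Rightarrow> real \<Rightarrow> real \<Rightarrow> (nat \<Rightarrow> real) \<Rightarrow> (real \<Rightarrow> nat \<Rightarrow> real) \<Rightarrow> (real \<Rightarrow> nat \<Rightarrow> real) \<Rightarrow> bool"
where
  "inertial_kuramoto_solution N m K \<Omega> \<Theta> \<Theta>' \<longleftrightarrow>
    (\<forall>i\<in>{1..N}.
      (\<forall>t\<ge>0. ((\<lambda>s. \<Theta> s i) has_real_derivative \<Theta>' t i) (at t within {0..})) \<and>
      continuous_on {0..} (\<lambda>t. \<Theta>' t i) \<and>
      (\<forall>t>0. \<exists>a. ((\<lambda>s. \<Theta>' s i) has_real_derivative a) (at t) \<and>
        m * a + \<Theta>' t i = \<Omega> i + (K / real N) * (\<Sum>j = 1..N. sin (\<Theta> t j - \<Theta> t i))))"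

end

theory Submission
  imports Defs
begin

text \<open>Frequency differences relax exponentially to the range allowed by the forces, so they stay
  below \<open>lam * K\<close> in the majority group, and for all pairs after some time.  Let
  \<open>L = pi - \<alpha> - \<beta> / 2\<close>.  If a phase difference reaches \<open>L\<close> modulo \<open>2 * pi\<close>, then it was within
  \<open>\<beta> / 4\<close> of \<open>L\<close> during the preceding \<open>m * ln ((lam + 2 * \<mu> + 2) / \<mu>)\<close> time units; throughout this
  window the majority pulls the pair together with force difference below \<open>- \<mu> * K\<close>, and the window
  is long enough for the relative velocity to become negative.  Hence the level cannot be crossed
  upwards and all phase differences stay bounded.  The energy of the system in the rotating frame is
  then bounded below, and it dissipates at rate \<open>\<Sum>i. (\<theta>\<^sub>i' - \<omega>)\<^sup>2\<close>, which tends to \<open>0\<close> by Barbalat's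
  argument.\<close>

section \<open>Scalar comparison, barrier and Barbalat arguments\<close>

text \<open>The integrating factor \<open>exp (t / m)\<close> turns the inequality into monotonicity
  of \<open>h\<close>. Derivatives enter only in the open interval, so \<open>a = 0\<close> is
  allowed although the second-order equation is given for positive times only.\<close>

lemma first_order_comparison:
  fixes v :: "real \<Rightarrow> real"
  assumes "a \<le> b" "0 < m" and cont: "continuous_on {a..b} v"
    and ode: "\<And>t. a < t \<Longrightarrow> t < b \<Longrightarrow> \<exists>d. (v has_real_derivative d) (at t) \<and> m * d + v t \<le> C"
  shows "v b \<le> C + exp (- (b - a) / m) * (v a - C)"
proof -
  define h where "h = (\<lambda>t. exp (t / m) * (v t - C))"
  have "h b \<le> h a"
  proof (rule DERIV_nonpos_imp_decreasing_open[OF \<open>a \<le> b\<close>])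
    fix t assume t: "a < t" "t < b"
    obtain d where d: "(v has_real_derivative d) (at t)" "m * d + v t \<le> C"
      using ode[OF t] by blast
    have "(h has_real_derivative exp (t / m) / m * (m * d + v t - C)) (at t)"
      unfolding h_def using \<open>0 < m\<close>
      by (auto intro!: derivative_eq_intros d(1) simp: field_simps)
    moreover have "exp (t / m) / m * (m * d + v t - C) \<le> 0"
      using d(2) \<open>0 < m\<close> by (intro mult_nonneg_nonpos) auto
    ultimately show "\<exists>y. (h has_real_derivative y) (at t) \<and> y \<le> 0" by blast
  next
    show "continuous_on {a..b} h"
      unfolding h_def using \<open>0 < m\<close> by (intro continuous_intros cont) auto
  qed
  then have "exp (- b / m) * h b \<le> exp (- b / m) * h a"
    by (intro mult_left_mono) auto
  then show ?thesis
    by (simp add: h_def mult_exp_exp diff_divide_distrib flip: mult.assoc)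
qed

text \<open>Let \<open>r\<close> be the earliest time at which any member of the family reaches
  \<open>L\<close>. All members are still at most \<open>L\<close> up to \<open>r\<close>, so
  \<open>decr\<close> applies there, and a negative derivative at \<open>r\<close> would put the
  curve above \<open>L\<close> just before \<open>r\<close>. The family is treated as a whole
  because \<open>decr\<close> for one member may rely on the bounds for all the others.\<close>

lemma first_crossing:
  fixes g :: "'p \<Rightarrow> real \<Rightarrow> real"
  assumes "finite P" and cont: "\<And>p. p \<in> P \<Longrightarrow> continuous_on {0..} (g p)"
    and init: "\<And>p. p \<in> P \<Longrightarrow> g p 0 < L"
    and decr: "\<And>t p. \<lbrakk>0 < t; p \<in> P; g p t = L; \<And>s q. 0 \<le> s \<Longrightarrow> s \<le> t \<Longrightarrow> q \<in> P \<Longrightarrow> g q s \<le> L\<rbrakk>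
      \<Longrightarrow> \<exists>d<0. (g p has_real_derivative d) (at t)"
    and "0 \<le> t" "p \<in> P"
  shows "g p t < L"
proof (rule ccontr)
  define S where "S = (\<Union>q\<in>P. {0..} \<inter> g q -` {L..})"
  assume "\<not> g p t < L"
  then have "t \<in> S" using \<open>0 \<le> t\<close> \<open>p \<in> P\<close> by (auto simp: S_def not_less)
  then have "S \<noteq> {}" by blast
  have "closed S"
    unfolding S_def using \<open>finite P\<close> cont by (intro closed_UN ballI continuous_closed_preimage) auto
  have bdd: "bdd_below S" by (rule bdd_belowI[of _ 0]) (auto simp: S_def)
  define r where "r = Inf S"
  have "r \<in> S" unfolding r_def by (rule closed_contains_Inf) fact+
  have before: "r \<le> s" if "s \<in> S" for s
    unfolding r_def using that bdd by (rule cInf_lower)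
  obtain q where q: "q \<in> P" "L \<le> g q r" "0 \<le> r" using \<open>r \<in> S\<close> by (auto simp: S_def)
  have "0 < r" using q init[OF q(1)] by (cases "r = 0") auto
  \<comment> \<open>A value above \<open>L\<close> at time \<open>s\<close> would force an exact hit
    of \<open>L\<close> at some \<open>x \<le> s\<close> by the intermediate value theorem;
    minimality of \<open>r\<close> gives \<open>x = s\<close>, where the value is not
    \<open>L\<close>.\<close>
  have below: "g u s \<le> L" if "0 \<le> s" "s \<le> r" "u \<in> P" for u s
  proof (rule ccontr)
    assume "\<not> g u s \<le> L"
    moreover have "continuous_on {0..s} (g u)"
      by (rule continuous_on_subset[OF cont[OF \<open>u \<in> P\<close>]]) auto
    ultimately obtain x where "0 \<le> x" "x \<le> s" "g u x = L"
      using IVT'[of "g u" 0 L s] init[OF \<open>u \<in> P\<close>] \<open>0 \<le> s\<close> by force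
    then have "x \<in> S" using \<open>u \<in> P\<close> by (auto simp: S_def)
    then have "x = s" using before \<open>x \<le> s\<close> \<open>s \<le> r\<close> by force
    then show False using \<open>g u x = L\<close> \<open>\<not> g u s \<le> L\<close> by simp
  qed
  have "g q r = L" using below[of r q] q by force
  then obtain d where "d < 0" "(g q has_real_derivative d) (at r)"
    using decr[OF \<open>0 < r\<close> q(1)] below by blast
  then obtain e where "0 < e" and e: "\<And>h. 0 < h \<Longrightarrow> h < e \<Longrightarrow> g q r < g q (r - h)"
    using DERIV_neg_dec_left by metis
  define h where "h = min r e / 2"
  have "0 < h" "h < e" "h \<le> r" using \<open>0 < r\<close> \<open>0 < e\<close> by (auto simp: h_def)
  then show False using e[of h] below[of "r - h" q] \<open>g q r = L\<close> q by simp
qed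

text \<open>A one-sided Barbalat lemma: since \<open>W\<close> cannot drop fast, a late value of at
  least \<open>e\<close> keeps \<open>W\<close> above \<open>e / 2\<close> for a fixed time, which
  dissipates more than \<open>E\<close> still has above its infimum.\<close>

lemma dissipation_tendsto_0:
  fixes E W :: "real \<Rightarrow> real"
  assumes E: "\<And>t. 0 < t \<Longrightarrow> (E has_real_derivative - W t) (at t)"
    and low: "\<And>t. 0 < t \<Longrightarrow> B \<le> E t"
    and W0: "\<And>t. 0 < t \<Longrightarrow> 0 \<le> W t"
    and W: "\<And>t. 0 < t \<Longrightarrow> \<exists>d. (W has_real_derivative d) (at t) \<and> - C \<le> d"
  shows "(W \<longlongrightarrow> 0) at_top"
proof (rule tendstoI)
  fix e :: real assume "0 < e"
  define c where "c = max C 1"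
  \<comment> \<open>Falling at rate at most \<open>c\<close>, \<open>W\<close> needs at least the
    time \<open>\<delta>\<close> to lose \<open>e / 2\<close>.\<close>
  define \<delta> where "\<delta> = e / (2 * c)"
  have "0 < c" "0 < \<delta>" using \<open>0 < e\<close> by (auto simp: c_def \<delta>_def)
  define l where "l = Inf (E ` {0<..})"
  have bdd: "bdd_below (E ` {0<..})" by (rule bdd_belowI[of _ B]) (auto simp: low)
  have l: "l \<le> E t" if "0 < t" for t
    unfolding l_def using bdd that by (intro cInf_lower) auto
  have "\<exists>t>0. E t < l + e / 2 * \<delta>"
    using cInf_lessD[of "E ` {0<..}" "l + e / 2 * \<delta>"] \<open>0 < \<delta>\<close> \<open>0 < e\<close> by (auto simp: l_def)
  then obtain r where r: "0 < r" "E r < l + e / 2 * \<delta>" by blast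
  have "W t < e" if "r \<le> t" for t
  proof (rule ccontr)
    assume "\<not> W t < e"
    have "0 < t" using r that by simp
    have large: "e / 2 \<le> W s" if s: "t \<le> s" "s \<le> t + \<delta>" for s
    proof -
      have "\<exists>y. ((\<lambda>u. W u + c * u) has_real_derivative y) (at x) \<and> 0 \<le> y" if x: "t \<le> x" for x
      proof -
        obtain d where "(W has_real_derivative d) (at x)" "- C \<le> d" using W[of x] x \<open>0 < t\<close> by force
        then show ?thesis
          by (intro exI[of _ "d + c"]) (auto intro!: derivative_eq_intros simp: c_def)
      qed
      then have "W t + c * t \<le> W s + c * s"
        by (intro DERIV_nonneg_imp_nondecreasing[OF s(1)]) auto
      moreover have "c * s - c * t \<le> e / 2"
        using mult_left_mono[of "s - t" \<delta> c] s \<open>0 < c\<close> by (simp add: \<delta>_def right_diff_distrib)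
      ultimately show ?thesis using \<open>\<not> W t < e\<close> by linarith
    qed
    \<comment> \<open>The trivial term \<open>t - t\<close> presents both sides as values of one
      nonincreasing function of \<open>u\<close>.\<close>
    have "E (t + \<delta>) + e / 2 * (t + \<delta> - t) \<le> E t + e / 2 * (t - t)"
    proof (rule DERIV_nonpos_imp_nonincreasing[where f = "\<lambda>u. E u + e / 2 * (u - t)"])
      show "t \<le> t + \<delta>" using \<open>0 < \<delta>\<close> by simp
      fix x assume x: "t \<le> x" "x \<le> t + \<delta>"
      then show "\<exists>y. ((\<lambda>u. E u + e / 2 * (u - t)) has_real_derivative y) (at x) \<and> y \<le> 0"
        using E[of x] large[OF x] \<open>0 < t\<close>
        by (intro exI[of _ "- W x + e / 2"]) (auto intro!: derivative_eq_intros)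
    qed
    moreover have "E t \<le> E r"
    proof (rule DERIV_nonpos_imp_nonincreasing[OF \<open>r \<le> t\<close>])
      fix x assume "r \<le> x"
      then show "\<exists>y. (E has_real_derivative y) (at x) \<and> y \<le> 0"
        using E[of x] W0[of x] r(1) by force
    qed
    ultimately show False
      using r(2) l[of "t + \<delta>"] \<open>0 < t\<close> \<open>0 < \<delta>\<close> by simp
  qed
  then show "\<forall>\<^sub>F t in at_top. dist (W t) 0 < e"
    unfolding eventually_at_top_linorder using W0 r(1) by (intro exI[of _ r]) force
qed

section \<open>Attraction exerted by the majority group\<close>

text \<open>The left-hand side is the difference of the coupling forces on two oscillators at phases
  \<open>a\<close> and \<open>b\<close>; the sum-to-product formula factors out \<open>sin ((a - b) / 2)\<close>.\<close>

lemma coupling_difference_le: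
  fixes \<phi> :: "nat \<Rightarrow> real" and \<alpha> \<beta> \<mu> a b :: real
  assumes "0 < N" "M \<le> N" "0 < \<beta>" "\<beta> < \<alpha>" "2 * \<beta> + \<alpha> < pi"
    and \<mu>: "\<mu> \<le> (real M / real N) * sin (\<alpha> / 2 - \<beta> / 4) * cos (\<alpha> / 2 + 5 / 8 * \<beta>)
           - (1 - real M / real N) * cos (\<alpha> / 2 - \<beta> / 8)"
    and ab: "pi - \<alpha> - 3 / 4 * \<beta> \<le> a - b" "a - b \<le> pi - \<alpha> - \<beta> / 2"
    and near: "\<And>l. l \<in> {1..M} \<Longrightarrow> a - \<phi> l \<le> pi - \<alpha> - \<beta> / 2 \<and> \<phi> l - b \<le> pi - \<alpha> - \<beta> / 2"
  shows "(\<Sum>l = 1..N. sin (\<phi> l - a)) - (\<Sum>l = 1..N. sin (\<phi> l - b)) \<le> - 2 * \<mu> * real N"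
proof -
  define x p q r where "x = (a - b) / 2" and "p = sin (\<alpha> / 2 - \<beta> / 4)"
    and "q = cos (\<alpha> / 2 + 5 / 8 * \<beta>)" and "r = cos (\<alpha> / 2 - \<beta> / 8)"
  have sincos: "sin (\<phi> l - a) - sin (\<phi> l - b) = - 2 * (sin x * cos (\<phi> l - (a + b) / 2))" for l
  proof -
    have "(\<phi> l - a - (\<phi> l - b)) / 2 = - x" "(\<phi> l - a + (\<phi> l - b)) / 2 = \<phi> l - (a + b) / 2"
      by (simp_all add: x_def field_simps)
    then show ?thesis by (simp only: sin_diff_sin sin_minus)
  qed
  have sin_co: "sin (pi / 2 - y) = cos y" "cos (pi / 2 - y) = sin y" for y :: real
    by (simp_all add: sin_diff cos_diff)
  \<comment> \<open>By \<open>ab\<close>, \<open>x\<close> lies between pi/2 - \<alpha>/2 -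
    3\<beta>/8 and pi/2 - \<alpha>/2 - \<beta>/4, where sine is increasing; \<open>q\<close> and
    \<open>r\<close> are sines of points on either side of this interval.\<close>
  have "q \<le> sin x"
    unfolding q_def sin_co(1)[symmetric] using assms
    by (subst sin_mono_le_eq) (auto simp: x_def field_simps)
  have "sin x \<le> r"
    unfolding r_def sin_co(1)[symmetric] using assms
    by (subst sin_mono_le_eq) (auto simp: x_def field_simps)
  have "0 \<le> q" "0 \<le> p"
    unfolding q_def p_def using assms by (auto intro!: cos_ge_zero sin_ge_zero)
  \<comment> \<open>Subtracting \<open>(a - b) / 2\<close> from the two bounds in
    \<open>near\<close> places each majority phase within pi/2 - \<alpha>/2 - \<beta>/8 of the
    midpoint of \<open>a\<close> and \<open>b\<close>.\<close>
  have "p \<le> cos (\<phi> l - (a + b) / 2)" if "l \<in> {1..M}" for l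
  proof -
    define y where "y = \<bar>\<phi> l - (a + b) / 2\<bar>"
    have "y \<le> pi / 2 - (\<alpha> / 2 - \<beta> / 4)"
      using near[OF that] ab assms(3) unfolding y_def by (auto simp: abs_if field_simps)
    then have "p \<le> cos y"
      unfolding p_def sin_co(2)[symmetric] using assms
      by (subst cos_mono_le_eq) (auto simp: y_def)
    then show ?thesis by (simp add: y_def)
  qed
  then have "q * p \<le> sin x * cos (\<phi> l - (a + b) / 2)" if "l \<in> {1..M}" for l
    using that \<open>q \<le> sin x\<close> \<open>0 \<le> q\<close> \<open>0 \<le> p\<close> by (intro mult_mono) auto
  then have "(\<Sum>l = 1..M. sin (\<phi> l - a) - sin (\<phi> l - b)) \<le> (\<Sum>l = 1..M. - 2 * (q * p))"
    by (intro sum_mono) (auto simp: sincos)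
  \<comment> \<open>Nothing is known about phases outside the majority, so the cosine is replaced by
    its worst value -1.\<close>
  moreover have "- (sin x * cos (\<phi> l - (a + b) / 2)) \<le> r" for l
  proof -
    have "sin x * (- cos (\<phi> l - (a + b) / 2)) \<le> sin x * 1"
      using \<open>q \<le> sin x\<close> \<open>0 \<le> q\<close> cos_ge_minus_one[of "\<phi> l - (a + b) / 2"]
      by (intro mult_left_mono) auto
    then show ?thesis using \<open>sin x \<le> r\<close> by simp
  qed
  then have "(\<Sum>l = M + 1..N. sin (\<phi> l - a) - sin (\<phi> l - b)) \<le> (\<Sum>l = M + 1..N. 2 * r)"
    by (intro sum_mono) (simp add: sincos)
  moreover have "(\<Sum>l = 1..N. F l) = (\<Sum>l = 1..M. F l) + (\<Sum>l = M + 1..N. F l)" for F :: "nat \<Rightarrow> real"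
    using \<open>M \<le> N\<close> by (subst sum.union_disjoint[symmetric]) (auto intro!: sum.cong)
  ultimately have "(\<Sum>l = 1..N. sin (\<phi> l - a) - sin (\<phi> l - b))
      \<le> - 2 * (real M * (q * p)) + 2 * ((real N - real M) * r)"
    using \<open>M \<le> N\<close> by (simp add: of_nat_diff)
  also have "\<dots> = - 2 * (real M / real N * p * q - (1 - real M / real N) * r) * real N"
    using \<open>0 < N\<close> by (simp add: field_simps)
  also have "\<dots> \<le> - 2 * \<mu> * real N"
    using \<mu> \<open>0 < N\<close> unfolding p_def[symmetric] q_def[symmetric] r_def[symmetric]
    by (intro mult_right_mono) auto
  finally show ?thesis by (simp add: sum_subtractf)
qed

lemma vec_diam_ge:
  assumes "i \<in> {1..n}" "j \<in> {1..n}"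
  shows "x i - x j \<le> vec_diam n x"
  unfolding vec_diam_def using assms by (intro Max_ge) force+

section \<open>Solutions: relaxation of velocities and a priori bounds\<close>

locale inertial_kuramoto =
  fixes N :: nat and m K :: real and \<Omega> :: "nat \<Rightarrow> real" and \<Theta> \<Theta>' :: "real \<Rightarrow> nat \<Rightarrow> real"
  assumes N_pos: "0 < N" and m_pos: "0 < m" and K_pos: "0 < K"
    and solution: "inertial_kuramoto_solution N m K \<Omega> \<Theta> \<Theta>'"
begin

definition force :: "real \<Rightarrow> nat \<Rightarrow> real" where
  "force t i = \<Omega> i + K / real N * (\<Sum>j = 1..N. sin (\<Theta> t j - \<Theta> t i))"

lemma phase_deriv:
  assumes "i \<in> {1..N}" "0 < t"
  shows "((\<lambda>s. \<Theta> s i) has_real_derivative \<Theta>' t i) (at t)"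
proof -
  have "((\<lambda>s. \<Theta> s i) has_real_derivative \<Theta>' t i) (at t within {0..})"
    using solution assms by (auto simp: inertial_kuramoto_solution_def)
  moreover have "at t within {0..} = at t"
    using \<open>0 < t\<close> by (intro at_within_interior) simp
  ultimately show ?thesis by simp
qed

lemma phase_continuous:
  assumes "i \<in> {1..N}"
  shows "continuous_on {0..} (\<lambda>t. \<Theta> t i)"
  using solution assms
  by (intro DERIV_continuous_on[where D = "\<lambda>t. \<Theta>' t i"]) (auto simp: inertial_kuramoto_solution_def)

lemma velocity_continuous:
  assumes "i \<in> {1..N}"
  shows "continuous_on {0..} (\<lambda>t. \<Theta>' t i)"
  using solution assms by (auto simp: inertial_kuramoto_solution_def)

lemma velocity_deriv:
  assumes "i \<in> {1..N}" "0 < t"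
  shows "((\<lambda>s. \<Theta>' s i) has_real_derivative (force t i - \<Theta>' t i) / m) (at t)"
proof -
  obtain a where "((\<lambda>s. \<Theta>' s i) has_real_derivative a) (at t)" and a: "m * a + \<Theta>' t i = force t i"
    using solution assms unfolding inertial_kuramoto_solution_def force_def by blast
  moreover have "a = (force t i - \<Theta>' t i) / m"
    using m_pos a by (simp add: field_simps)
  ultimately show ?thesis by simp
qed

text \<open>All oscillators share the inertia \<open>m\<close>, so the difference of two equations
  is again a scalar relaxation equation, driven by the force gap.\<close>

lemma velocity_gap_le:
  assumes ij: "i \<in> {1..N}" "j \<in> {1..N}" and "0 \<le> a" "a \<le> b"
    and C: "\<And>t. a < t \<Longrightarrow> t < b \<Longrightarrow> force t i - force t j \<le> C"
  shows "\<Theta>' b i - \<Theta>' b j \<le> C + exp (- (b - a) / m) * (\<Theta>' a i - \<Theta>' a j - C)"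
proof (rule first_order_comparison[OF \<open>a \<le> b\<close> m_pos])
  show "continuous_on {a..b} (\<lambda>t. \<Theta>' t i - \<Theta>' t j)"
    using \<open>0 \<le> a\<close>
    by (intro continuous_intros continuous_on_subset[OF velocity_continuous] ij) auto
next
  fix t assume t: "a < t" "t < b"
  then have "0 < t" using \<open>0 \<le> a\<close> by simp
  show "\<exists>d. ((\<lambda>t. \<Theta>' t i - \<Theta>' t j) has_real_derivative d) (at t) \<and> m * d + (\<Theta>' t i - \<Theta>' t j) \<le> C"
    using C[OF t] m_pos DERIV_diff[OF velocity_deriv[OF ij(1) \<open>0 < t\<close>] velocity_deriv[OF ij(2) \<open>0 < t\<close>]]
    by (auto intro!: exI simp flip: diff_divide_distrib)
qed

lemma phase_gap_growth:
  assumes ij: "i \<in> {1..N}" "j \<in> {1..N}" and "0 \<le> a" "a \<le> b"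
    and D: "\<And>t. a < t \<Longrightarrow> t < b \<Longrightarrow> \<Theta>' t i - \<Theta>' t j \<le> D"
  shows "(\<Theta> b i - \<Theta> b j) - (\<Theta> a i - \<Theta> a j) \<le> D * (b - a)"
proof -
  have "\<Theta> b i - \<Theta> b j - D * b \<le> \<Theta> a i - \<Theta> a j - D * a"
  proof (rule DERIV_nonpos_imp_decreasing_open[OF \<open>a \<le> b\<close>])
    show "continuous_on {a..b} (\<lambda>t. \<Theta> t i - \<Theta> t j - D * t)"
      using \<open>0 \<le> a\<close>
      by (intro continuous_intros continuous_on_subset[OF phase_continuous] ij) auto
    fix t assume t: "a < t" "t < b"
    then have "0 < t" using \<open>0 \<le> a\<close> by simp
    show "\<exists>y. ((\<lambda>t. \<Theta> t i - \<Theta> t j - D * t) has_real_derivative y) (at t) \<and> y \<le> 0"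
      using D[OF t] phase_deriv[OF ij(1) \<open>0 < t\<close>] phase_deriv[OF ij(2) \<open>0 < t\<close>]
      by (intro exI[of _ "\<Theta>' t i - \<Theta>' t j - D"]) (auto intro!: derivative_eq_intros)
  qed
  then show ?thesis by (simp add: right_diff_distrib)
qed

lemma coupling_bound: "\<bar>K / real N * (\<Sum>j = 1..N. sin (\<Theta> t j - \<Theta> t i))\<bar> \<le> K"
proof -
  have "\<bar>\<Sum>j = 1..N. sin (\<Theta> t j - \<Theta> t i)\<bar> \<le> (\<Sum>j = 1..N. 1)"
    by (intro order_trans[OF sum_abs] sum_mono) simp
  then show ?thesis
    using N_pos K_pos by (simp add: abs_mult field_simps)
qed

lemma force_gap_le:
  assumes "i \<in> {1..N}" "j \<in> {1..N}"
  shows "force t i - force t j \<le> vec_diam N \<Omega> + 2 * K"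
  using coupling_bound[of t i] coupling_bound[of t j] vec_diam_ge[OF assms, of \<Omega>]
  unfolding force_def by linarith

lemma force_bounded:
  obtains F where "\<And>t i. i \<in> {1..N} \<Longrightarrow> \<bar>force t i\<bar> \<le> F"
proof (rule that)
  fix t i assume "i \<in> {1..N}"
  then have "\<bar>\<Omega> i\<bar> \<le> (\<Sum>j = 1..N. \<bar>\<Omega> j\<bar>)" by (intro member_le_sum) auto
  then show "\<bar>force t i\<bar> \<le> (\<Sum>j = 1..N. \<bar>\<Omega> j\<bar>) + K"
    using coupling_bound[of t i] unfolding force_def by linarith
qed

lemma velocity_bounded:
  obtains V where "\<And>t i. 0 \<le> t \<Longrightarrow> i \<in> {1..N} \<Longrightarrow> \<bar>\<Theta>' t i\<bar> \<le> V"
proof -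
  obtain F where F: "\<And>t i. i \<in> {1..N} \<Longrightarrow> \<bar>force t i\<bar> \<le> F" using force_bounded by blast
  show ?thesis
  proof (rule that)
    fix t :: real and i assume t: "0 \<le> t" and i: "i \<in> {1..N}"
    \<comment> \<open>Stated for a general \<open>v\<close> so that it serves both the velocity and
      its negative.\<close>
    have bound: "v t \<le> 2 * F + \<bar>v 0\<bar>"
      if v: "continuous_on {0..} v"
        "\<And>s. 0 < s \<Longrightarrow> \<exists>d. (v has_real_derivative d) (at s) \<and> m * d + v s \<le> F" for v
    proof -
      have "v t \<le> F + exp (- (t - 0) / m) * (v 0 - F)"
        using t m_pos v by (intro first_order_comparison continuous_on_subset[OF v(1)]) auto
      moreover have "exp (- (t - 0) / m) * (v 0 - F) \<le> \<bar>v 0 - F\<bar>"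
      proof -
        have "exp (- (t - 0) / m) * (v 0 - F) \<le> exp (- (t - 0) / m) * \<bar>v 0 - F\<bar>"
          by (intro mult_left_mono) auto
        also have "\<dots> \<le> 1 * \<bar>v 0 - F\<bar>"
          using t m_pos by (intro mult_right_mono) auto
        finally show ?thesis by simp
      qed
      moreover have "\<bar>v 0 - F\<bar> \<le> \<bar>v 0\<bar> + F"
        using abs_triangle_ineq4[of "v 0" F] F[OF i, of 0] by linarith
      ultimately show ?thesis by linarith
    qed
    have "\<Theta>' t i \<le> 2 * F + \<bar>\<Theta>' 0 i\<bar>"
    proof (rule bound[OF velocity_continuous[OF i]])
      fix s :: real assume "0 < s"
      then show "\<exists>d. ((\<lambda>s. \<Theta>' s i) has_real_derivative d) (at s) \<and> m * d + \<Theta>' s i \<le> F"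
        using F[OF i, of s] m_pos velocity_deriv[OF i] by (intro exI conjI) auto
    qed
    moreover have "- \<Theta>' t i \<le> 2 * F + \<bar>- \<Theta>' 0 i\<bar>"
    proof (rule bound[OF continuous_on_minus[OF velocity_continuous[OF i]]])
      fix s :: real assume "0 < s"
      then show "\<exists>d. ((\<lambda>s. - \<Theta>' s i) has_real_derivative d) (at s) \<and> m * d + - \<Theta>' s i \<le> F"
        using F[OF i, of s] m_pos
        by (intro exI[of _ "- ((force s i - \<Theta>' s i) / m)"] conjI DERIV_minus velocity_deriv[OF i]) auto
    qed
    ultimately have "\<bar>\<Theta>' t i\<bar> \<le> 2 * F + \<bar>\<Theta>' 0 i\<bar>" by simp
    also have "\<bar>\<Theta>' 0 i\<bar> \<le> (\<Sum>j = 1..N. \<bar>\<Theta>' 0 j\<bar>)" using i by (intro member_le_sum) auto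
    finally show "\<bar>\<Theta>' t i\<bar> \<le> 2 * F + (\<Sum>j = 1..N. \<bar>\<Theta>' 0 j\<bar>)" by simp
  qed
qed

section \<open>Energy dissipation and convergence of the frequencies\<close>

text \<open>Sine is odd, so exchanging \<open>i\<close> and \<open>j\<close> shows that the two
  halves of the left-hand side are equal. With velocities for \<open>v\<close> this links the
  derivative of the cosine potential to the power of the coupling forces.\<close>

lemma sum_coupling_mult_difference:
  fixes v :: "nat \<Rightarrow> real"
  shows "(\<Sum>i = 1..N. \<Sum>j = 1..N. sin (\<Theta> t j - \<Theta> t i) * (v j - v i))
    = - 2 * (\<Sum>i = 1..N. v i * (\<Sum>j = 1..N. sin (\<Theta> t j - \<Theta> t i)))"
proof -
  have "(\<Sum>i = 1..N. \<Sum>j = 1..N. sin (\<Theta> t j - \<Theta> t i) * v j)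
      = (\<Sum>i = 1..N. \<Sum>j = 1..N. - (v i * sin (\<Theta> t j - \<Theta> t i)))"
    by (subst sum.swap) (simp add: sin_diff algebra_simps)
  moreover have "(\<Sum>i = 1..N. \<Sum>j = 1..N. sin (\<Theta> t j - \<Theta> t i) * (v j - v i))
      = (\<Sum>i = 1..N. \<Sum>j = 1..N. sin (\<Theta> t j - \<Theta> t i) * v j)
        - (\<Sum>i = 1..N. \<Sum>j = 1..N. v i * sin (\<Theta> t j - \<Theta> t i))"
    by (simp add: algebra_simps flip: sum_subtractf)
  ultimately show ?thesis
    by (simp add: sum_negf flip: sum_distrib_left)
qed

lemma sum_coupling_eq_0: "(\<Sum>i = 1..N. \<Sum>j = 1..N. sin (\<Theta> t j - \<Theta> t i)) = 0"
  using sum_coupling_mult_difference[of t "\<lambda>_. 1"] by simp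

text \<open>Kinetic energy in the frame rotating with the mean frequency, a linear potential of the
  centred frequencies, and the coupling potential, halved because every pair is counted twice.
  Unrotated phases may be used because the centred frequencies sum to zero.\<close>

definition energy :: "real \<Rightarrow> real" where
  "energy t = (\<Sum>i = 1..N. m / 2 * (\<Theta>' t i - vec_mean N \<Omega>)^2 - (\<Omega> i - vec_mean N \<Omega>) * \<Theta> t i)
    - K / (2 * real N) * (\<Sum>i = 1..N. \<Sum>j = 1..N. cos (\<Theta> t j - \<Theta> t i))"

lemma sum_centered_eq_0: "(\<Sum>i = 1..N. \<Omega> i - vec_mean N \<Omega>) = 0"
  using N_pos by (simp add: vec_mean_def sum_subtractf)

text \<open>The power of the coupling forces cancels against the derivative of the cosine potential.
  What remains besides friction carries a factor \<open>w\<close> and vanishes, since both the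
  centred frequencies and the coupling forces sum to zero.\<close>

lemma energy_deriv:
  assumes "0 < t"
  shows "(energy has_real_derivative - (\<Sum>i = 1..N. (\<Theta>' t i - vec_mean N \<Omega>)^2)) (at t)"
proof -
  define w where "w = vec_mean N \<Omega>"
  define v where "v = \<Theta>' t"
  define k where "k = K / real N"
  define S where "S i = (\<Sum>j = 1..N. sin (\<Theta> t j - \<Theta> t i))" for i
  note [derivative_intros] = phase_deriv[OF _ assms] velocity_deriv[OF _ assms]
  have "(energy has_real_derivative
      (\<Sum>i = 1..N. (v i - w) * (force t i - v i) - (\<Omega> i - w) * v i)
      + K / (2 * real N) * (\<Sum>i = 1..N. \<Sum>j = 1..N. sin (\<Theta> t j - \<Theta> t i) * (v j - v i))) (at t)"
    unfolding energy_def w_def[symmetric]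
    by (rule derivative_eq_intros refl | simp)+
      (use m_pos N_pos in \<open>auto simp: v_def sum_negf mult.commute\<close>)
  moreover have "(\<Sum>i = 1..N. (v i - w) * (force t i - v i) - (\<Omega> i - w) * v i)
      = - (\<Sum>i = 1..N. (v i - w)^2) + (\<Sum>i = 1..N. k * (v i * S i))"
  proof -
    have "(v i - w) * (force t i - v i) - (\<Omega> i - w) * v i
        = - ((v i - w)^2) + k * (v i * S i) - w * (\<Omega> i - w) - k * w * S i" for i
    proof -
      have "force t i = \<Omega> i + k * S i" by (simp only: force_def k_def S_def)
      then show ?thesis by (simp add: power2_eq_square algebra_simps)
    qed
    then have "(\<Sum>i = 1..N. (v i - w) * (force t i - v i) - (\<Omega> i - w) * v i)
        = - (\<Sum>i = 1..N. (v i - w)^2) + (\<Sum>i = 1..N. k * (v i * S i))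
          - (\<Sum>i = 1..N. w * (\<Omega> i - w)) - (\<Sum>i = 1..N. k * w * S i)"
      by (simp only: sum_subtractf sum.distrib sum_negf)
    moreover have "(\<Sum>i = 1..N. w * (\<Omega> i - w)) = 0"
      using sum_centered_eq_0 by (simp add: w_def flip: sum_distrib_left)
    moreover have "(\<Sum>i = 1..N. k * w * S i) = 0"
      using sum_coupling_eq_0[of t] by (simp add: S_def flip: sum_distrib_left)
    ultimately show ?thesis by simp
  qed
  moreover have "K / (2 * real N) * (\<Sum>i = 1..N. \<Sum>j = 1..N. sin (\<Theta> t j - \<Theta> t i) * (v j - v i))
      = - (\<Sum>i = 1..N. k * (v i * S i))"
    unfolding sum_coupling_mult_difference S_def k_def by (simp add: sum_distrib_left sum_negf)
  ultimately show ?thesis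
    by (simp add: v_def w_def)
qed

text \<open>Because the centred frequencies sum to zero, the linear potential depends on phase
  differences only; phase 1 serves as the reference.\<close>

lemma energy_lower_bound:
  assumes "\<And>i j. i \<in> {1..N} \<Longrightarrow> j \<in> {1..N} \<Longrightarrow> \<Theta> t i - \<Theta> t j \<le> B"
  shows "- (\<Sum>i = 1..N. \<bar>\<Omega> i - vec_mean N \<Omega>\<bar> * B) - K / (2 * real N) * (real N * real N) \<le> energy t"
proof -
  define w where "w = vec_mean N \<Omega>"
  have "(\<Sum>i = 1..N. (\<Omega> i - w) * \<Theta> t i)
      = (\<Sum>i = 1..N. (\<Omega> i - w) * (\<Theta> t i - \<Theta> t 1)) + (\<Sum>i = 1..N. \<Omega> i - w) * \<Theta> t 1"
    by (subst sum_distrib_right, subst sum.distrib[symmetric]) (simp add: algebra_simps)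
  also have "\<dots> \<le> (\<Sum>i = 1..N. \<bar>\<Omega> i - w\<bar> * B)"
  proof -
    have "(\<Omega> i - w) * (\<Theta> t i - \<Theta> t 1) \<le> \<bar>\<Omega> i - w\<bar> * B" if "i \<in> {1..N}" for i
    proof -
      have "(\<Omega> i - w) * (\<Theta> t i - \<Theta> t 1) \<le> \<bar>\<Omega> i - w\<bar> * \<bar>\<Theta> t i - \<Theta> t 1\<bar>"
        unfolding abs_mult[symmetric] by (rule abs_ge_self)
      also have "\<dots> \<le> \<bar>\<Omega> i - w\<bar> * B"
        using assms[of i 1] assms[of 1 i] that by (intro mult_left_mono) auto
      finally show ?thesis .
    qed
    then have "(\<Sum>i = 1..N. (\<Omega> i - w) * (\<Theta> t i - \<Theta> t 1)) \<le> (\<Sum>i = 1..N. \<bar>\<Omega> i - w\<bar> * B)"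
      by (rule sum_mono)
    then show ?thesis
      unfolding w_def sum_centered_eq_0 by simp
  qed
  finally have "(\<Sum>i = 1..N. (\<Omega> i - w) * \<Theta> t i) \<le> (\<Sum>i = 1..N. \<bar>\<Omega> i - w\<bar> * B)" .
  moreover have "K / (2 * real N) * (\<Sum>i = 1..N. \<Sum>j = 1..N. cos (\<Theta> t j - \<Theta> t i))
      \<le> K / (2 * real N) * (\<Sum>i = 1..N. \<Sum>j = 1..N. 1)"
    using K_pos by (intro mult_left_mono sum_mono) auto
  moreover have "0 \<le> (\<Sum>i = 1..N. m / 2 * (\<Theta>' t i - w)^2)"
    using m_pos by (intro sum_nonneg) auto
  ultimately show ?thesis
    by (simp add: energy_def w_def sum_subtractf)
qed

lemma velocity_tendsto_mean:
  assumes bounded: "\<And>t i j. 0 \<le> t \<Longrightarrow> i \<in> {1..N} \<Longrightarrow> j \<in> {1..N} \<Longrightarrow> \<Theta> t i - \<Theta> t j \<le> B"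
    and i: "i \<in> {1..N}"
  shows "((\<lambda>t. \<Theta>' t i) \<longlongrightarrow> vec_mean N \<Omega>) at_top"
proof -
  define w where "w = vec_mean N \<Omega>"
  define W where "W t = (\<Sum>i = 1..N. (\<Theta>' t i - w)^2)" for t
  obtain F where F: "\<And>t i. i \<in> {1..N} \<Longrightarrow> \<bar>force t i\<bar> \<le> F" using force_bounded by blast
  obtain V where V: "\<And>t i. 0 \<le> t \<Longrightarrow> i \<in> {1..N} \<Longrightarrow> \<bar>\<Theta>' t i\<bar> \<le> V" using velocity_bounded by blast
  have "(W \<longlongrightarrow> 0) at_top"
  proof (rule dissipation_tendsto_0)
    fix t :: real assume t: "0 < t"
    show "(energy has_real_derivative - W t) (at t)"
      using energy_deriv[OF t] by (simp add: W_def w_def)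
    show "- (\<Sum>i = 1..N. \<bar>\<Omega> i - w\<bar> * B) - K / (2 * real N) * (real N * real N) \<le> energy t"
      using energy_lower_bound[of t B] bounded[of t] t by (simp add: w_def)
    show "0 \<le> W t" unfolding W_def by (intro sum_nonneg) auto
    note [derivative_intros] = velocity_deriv[OF _ t]
    have "(W has_real_derivative (\<Sum>i = 1..N. 2 * (\<Theta>' t i - w) * ((force t i - \<Theta>' t i) / m))) (at t)"
      unfolding W_def
      by (rule derivative_eq_intros refl | simp)+ (auto intro!: sum.cong simp: field_simps)
    moreover have "(\<Sum>i = 1..N. - (2 * (V + \<bar>w\<bar>) * ((F + V) / m)))
        \<le> (\<Sum>i = 1..N. 2 * (\<Theta>' t i - w) * ((force t i - \<Theta>' t i) / m))"
    proof (rule sum_mono)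
      fix j assume j: "j \<in> {1..N}"
      have "\<bar>2 * (\<Theta>' t j - w) * ((force t j - \<Theta>' t j) / m)\<bar>
          = 2 * \<bar>\<Theta>' t j - w\<bar> * (\<bar>force t j - \<Theta>' t j\<bar> / m)"
        unfolding abs_mult abs_divide using m_pos by simp
      also have "\<dots> \<le> 2 * (V + \<bar>w\<bar>) * ((F + V) / m)"
        using F[OF j, of t] V[of t j] j t m_pos by (intro mult_mono divide_right_mono) auto
      finally show "- (2 * (V + \<bar>w\<bar>) * ((F + V) / m))
          \<le> 2 * (\<Theta>' t j - w) * ((force t j - \<Theta>' t j) / m)"
        by (rule minus_le_iff[THEN iffD1, OF abs_le_D2])
    qed
    ultimately show "\<exists>d. (W has_real_derivative d) (at t)
        \<and> - (real N * (2 * (V + \<bar>w\<bar>) * ((F + V) / m))) \<le> d"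
      by (intro exI conjI) (simp_all add: sum_negf)
  qed
  then have "((\<lambda>t. (\<Theta>' t i - w)^2) \<longlongrightarrow> 0) at_top"
  proof (rule tendsto_sandwich[OF _ _ tendsto_const, rotated 2])
    show "\<forall>\<^sub>F t in at_top. (\<Theta>' t i - w)^2 \<le> W t"
      unfolding W_def using i by (intro always_eventually allI member_le_sum) auto
  qed auto
  then show ?thesis
    by (simp add: power_tendsto_0_iff LIM_zero_iff w_def)
qed

section \<open>Boundedness of all phase differences\<close>

lemma phases_bounded:
  fixes M :: nat and \<alpha> \<beta> \<mu> lam :: real
  assumes "M \<le> N" "0 < \<beta>" "\<beta> < \<alpha>" "2 * \<beta> + \<alpha> < pi"
    and "0 < \<mu>"
    and \<mu>: "\<mu> \<le> (real M / real N) * sin (\<alpha> / 2 - \<beta> / 4) * cos (\<alpha> / 2 + 5 / 8 * \<beta>)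
           - (1 - real M / real N) * cos (\<alpha> / 2 - \<beta> / 8)"
    and lam: "lam > \<mu> + 2"
    and inertia: "m * K \<le> \<beta> / (4 * (lam + \<mu> + 2) * ln ((lam + 2 * \<mu> + 2) / \<mu>))"
    and \<Omega>: "vec_diam N \<Omega> < \<mu> * K"
    and phases_0: "vec_diam M (\<Theta> 0) \<le> pi - \<alpha> - \<beta>"
    and velocities_0: "vec_diam M (\<Theta>' 0) < lam * K"
  obtains B where "\<And>t a b. 0 \<le> t \<Longrightarrow> a \<in> {1..N} \<Longrightarrow> b \<in> {1..N} \<Longrightarrow> \<Theta> t a - \<Theta> t b \<le> B"
proof -
  define L where "L = pi - \<alpha> - \<beta> / 2"
  \<comment> \<open>During time \<open>T\<close> a velocity gap is relaxed by the factor
    \<open>R\<close>, chosen so that \<open>(lam + \<mu>) / R < \<mu>\<close>.\<close>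
  define R where "R = (lam + 2 * \<mu> + 2) / \<mu>"
  define T where "T = m * ln R"
  have "1 < R" using \<open>0 < \<mu>\<close> lam by (simp add: R_def)
  then have "0 < T" and exp_T: "exp (- T / m) = 1 / R"
    using m_pos by (simp_all add: T_def exp_minus divide_simps)
  have "K * T * (lam + \<mu> + 2) \<le> \<beta> / 4"
  proof -
    have "m * K \<le> \<beta> / (4 * (lam + \<mu> + 2) * ln R)" using inertia by (simp add: R_def)
    moreover have "0 < 4 * (lam + \<mu> + 2) * ln R" using \<open>0 < \<mu>\<close> lam \<open>1 < R\<close> by simp
    ultimately have "m * K * (4 * (lam + \<mu> + 2) * ln R) \<le> \<beta>" by (simp add: pos_le_divide_eq)
    then show ?thesis by (simp add: T_def algebra_simps)
  qed
  moreover have "lam * K * T \<le> K * T * (lam + \<mu> + 2)"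
    using mult_left_mono[of lam "lam + \<mu> + 2" "K * T"] \<open>0 < \<mu>\<close> \<open>0 < T\<close> K_pos by (simp add: mult_ac)
  \<comment> \<open>At relative speed at most \<open>lam * K\<close>, a phase gap grows by at most
    \<beta>/4 during time \<open>T\<close>.\<close>
  ultimately have lamKT: "lam * K * T \<le> \<beta> / 4" by linarith
  have lamK: "0 < lam * K" "(\<mu> + 2) * K < lam * K" using \<open>0 < \<mu>\<close> lam K_pos by auto

  have relax: "\<Theta>' t a - \<Theta>' t b
      \<le> (\<mu> + 2) * K + exp (- t / m) * (\<Theta>' 0 a - \<Theta>' 0 b - (\<mu> + 2) * K)"
    if "0 \<le> t" "a \<in> {1..N}" "b \<in> {1..N}" for t a b
  proof -
    have "force s a - force s b \<le> (\<mu> + 2) * K" for s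
      using force_gap_le[of a b s] that \<Omega> by (simp add: algebra_simps)
    then show ?thesis using velocity_gap_le[of a b 0 t "(\<mu> + 2) * K"] that by simp
  qed
  have group: "\<Theta>' t a - \<Theta>' t b \<le> lam * K" if "0 \<le> t" "a \<in> {1..M}" "b \<in> {1..M}" for t a b
  proof -
    have "\<Theta>' 0 a - \<Theta>' 0 b \<le> lam * K"
      using vec_diam_ge[of a M b "\<Theta>' 0"] velocities_0 that by simp
    then have "exp (- t / m) * (\<Theta>' 0 a - \<Theta>' 0 b - (\<mu> + 2) * K) \<le> 1 * (lam * K - (\<mu> + 2) * K)"
      using lamK \<open>0 \<le> t\<close> m_pos by (intro order_trans[OF mult_left_mono mult_right_mono]) auto
    then show ?thesis using relax[of t a b] that \<open>M \<le> N\<close> by simp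
  qed
  \<comment> \<open>The limiting bound \<open>(\<mu> + 2) * K\<close> is strictly below
    \<open>lam * K\<close>, so even pairs with large initial velocity gaps eventually obey the
    majority's bound.\<close>
  have "\<forall>\<^sub>F t in at_top. 0 \<le> t \<and> (\<forall>p\<in>{1..N} \<times> {1..N}. \<Theta>' t (fst p) - \<Theta>' t (snd p) \<le> lam * K)"
  proof (intro eventually_conj eventually_ge_at_top eventually_ball_finite ballI)
    fix p assume p: "p \<in> {1..N} \<times> {1..N}"
    define c where "c = \<Theta>' 0 (fst p) - \<Theta>' 0 (snd p) - (\<mu> + 2) * K"
    have "filterlim (\<lambda>t. (- 1 / m) * t) at_bot at_top"
      using m_pos by (intro filterlim_tendsto_neg_mult_at_bot[OF tendsto_const _ filterlim_ident]) auto
    then have "((\<lambda>t. exp (- t / m)) \<longlongrightarrow> 0) at_top"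
      using filterlim_compose[OF exp_at_bot] by fastforce
    then have lim: "((\<lambda>t. (\<mu> + 2) * K + exp (- t / m) * c) \<longlongrightarrow> (\<mu> + 2) * K + 0 * c) at_top"
      by (intro tendsto_intros)
    have "\<forall>\<^sub>F t in at_top. (\<mu> + 2) * K + exp (- t / m) * c < lam * K"
      using lamK by (intro order_tendstoD(2)[OF lim]) simp
    then show "\<forall>\<^sub>F t in at_top. \<Theta>' t (fst p) - \<Theta>' t (snd p) \<le> lam * K"
      using eventually_ge_at_top[of 0]
    proof eventually_elim
      case (elim t)
      then show ?case using relax[of t "fst p" "snd p"] p by (auto simp: c_def)
    qed
  qed auto
  then obtain T0 where T0: "\<forall>t\<ge>T0. 0 \<le> t \<and>
      (\<forall>p\<in>{1..N} \<times> {1..N}. \<Theta>' t (fst p) - \<Theta>' t (snd p) \<le> lam * K)"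
    unfolding eventually_at_top_linorder by blast
  then have "0 \<le> T0" by simp
  have settled: "\<Theta>' t a - \<Theta>' t b \<le> lam * K" if "T0 \<le> t" "a \<in> {1..N}" "b \<in> {1..N}" for t a b
    using bspec[of "{1..N} \<times> {1..N}" _ "(a, b)"] T0 that by simp

  define S where "S = (\<Union>a\<in>{1..N}. \<Union>b\<in>{1..N}. (\<lambda>t. \<Theta> t a - \<Theta> t b) ` {0..T0 + T})"
  have "bounded S"
    unfolding S_def
    by (intro bounded_UN finite_atLeastAtMost ballI compact_imp_bounded compact_continuous_image
        continuous_on_diff continuous_on_subset[OF phase_continuous] compact_Icc) auto
  then obtain B0 where S: "\<forall>x\<in>S. \<bar>x\<bar> \<le> B0"
    unfolding bounded_real by blast
  have B0: "\<Theta> t a - \<Theta> t b \<le> B0"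
    if "0 \<le> t" "t \<le> T0 + T" "a \<in> {1..N}" "b \<in> {1..N}" for t a b
  proof -
    have "\<Theta> t a - \<Theta> t b \<in> S"
      unfolding S_def using that by (intro UN_I[of a] UN_I[of b] image_eqI[of _ _ t]) auto
    then have "\<bar>\<Theta> t a - \<Theta> t b\<bar> \<le> B0" using S by blast
    then show ?thesis by (rule abs_le_D1)
  qed
  obtain n :: nat where n: "B0 - L < real n * (2 * pi)"
    using reals_Archimedean3[of "2 * pi"] pi_gt_zero by auto
  txt \<open>Oscillators outside the majority enter with a phase shift by a multiple of \<open>2 * pi\<close> so
    large that their barrier cannot be reached before time \<open>T0 + T\<close>.  A single first-crossing
    argument then treats all pairs at once.\<close>
  define c where "c a = (if a \<le> M then 0 else 2 * real n * pi)" for a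
  have c_nonneg: "0 \<le> c a" for a by (simp add: c_def)
  have sin_c: "sin (y + c a) = sin y" "sin (y - c a) = sin y" for y a
    by (simp_all add: c_def sin_add sin_diff sin_2npi cos_2npi)
  \<comment> \<open>The first phase is shifted down and the second up, so every shift lowers the
    gap. For \<open>l\<close> in the majority, \<open>g (a, l)\<close> and \<open>g (l, b)\<close>
    are the gaps from the shifted phases to \<open>l\<close> that the attraction estimate
    needs.\<close>
  define g where "g p t = (\<Theta> t (fst p) - c (fst p)) - (\<Theta> t (snd p) + c (snd p))" for p t
  have early: "g (a, b) t < L"
    if "0 \<le> t" "t \<le> T0 + T" "a \<in> {1..N}" "b \<in> {1..N}" "\<not> (a \<le> M \<and> b \<le> M)" for a b t
    using B0[of t a b] that n c_nonneg[of a] c_nonneg[of b]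
    by (auto simp: g_def c_def mult_ac split: if_splits)
  have group_0: "g (a, b) 0 \<le> pi - \<alpha> - \<beta>"
    if "a \<in> {1..N}" "b \<in> {1..N}" "a \<le> M" "b \<le> M" for a b
    using vec_diam_ge[of a M b "\<Theta> 0"] phases_0 that by (simp add: g_def c_def)

  have barrier: "g p t < L" if "0 \<le> t" "p \<in> {1..N} \<times> {1..N}" for p t
  proof (rule first_crossing[OF _ _ _ _ that])
    show "continuous_on {0..} (g p)" if "p \<in> {1..N} \<times> {1..N}" for p
      unfolding g_def using that by (intro continuous_intros phase_continuous) auto
    show "g p 0 < L" if "p \<in> {1..N} \<times> {1..N}" for p
    proof (cases p)
      case (Pair a b)
      then show ?thesis
        using early[of 0 a b] group_0[of a b] that \<open>0 < T\<close> \<open>0 \<le> T0\<close> \<open>0 < \<beta>\<close>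
        by (cases "a \<le> M \<and> b \<le> M") (auto simp: L_def)
    qed
  next
    fix t p
    assume "0 < t" and p: "p \<in> {1..N} \<times> {1..N}" "g p t = L"
      and below: "\<And>s q. \<lbrakk>0 \<le> s; s \<le> t; q \<in> {1..N} \<times> {1..N}\<rbrakk> \<Longrightarrow> g q s \<le> L"
    obtain a b where ab: "p = (a, b)" "a \<in> {1..N}" "b \<in> {1..N}" using p by auto
    have growth: "L - g p s \<le> lam * K * (t - s)"
      if "0 \<le> s" "s \<le> t" "\<And>u. s < u \<Longrightarrow> u < t \<Longrightarrow> \<Theta>' u a - \<Theta>' u b \<le> lam * K" for s
      using phase_gap_growth[of a b s t "lam * K"] ab p(2) that by (simp add: g_def)
    \<comment> \<open>A majority pair has to climb at least \<beta>/2 to reach \<open>L\<close>,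
      which takes longer than \<open>T\<close>. Any other pair reaches \<open>L\<close> only after
      \<open>T0 + T\<close>, so its window starts after \<open>T0\<close>.\<close>
    have window: "T \<le> t \<and> (\<forall>s\<ge>t - T. \<Theta>' s a - \<Theta>' s b \<le> lam * K)"
    proof (cases "a \<le> M \<and> b \<le> M")
      case True
      then have "L - (pi - \<alpha> - \<beta>) \<le> lam * K * t"
        using growth[of 0] group[of _ a b] group_0[of a b] ab \<open>0 < t\<close> by simp
      then have "lam * K * T < lam * K * t" using lamKT \<open>0 < \<beta>\<close> by (simp add: L_def)
      then have "T \<le> t" using mult_left_less_imp_less[of "lam * K" T t] lamK(1) by linarith
      then show ?thesis using group[of _ a b] ab True by simp
    next
      case False
      then have "T0 + T < t" using early[of t a b] ab p(2) \<open>0 < t\<close> by force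
      then show ?thesis using settled[of _ a b] ab \<open>0 \<le> T0\<close> by simp
    qed
    \<comment> \<open>The coupling contributes at most \<open>- 2 * \<mu> * K\<close>, and the
      natural frequencies give back less than \<open>\<mu> * K\<close>.\<close>
    have drift: "force s a - force s b \<le> - \<mu> * K" if s: "t - T \<le> s" "s \<le> t" for s
    proof -
      have "0 \<le> s" using s window by simp
      have "L - g p s \<le> lam * K * (t - s)" using growth[OF \<open>0 \<le> s\<close> s(2)] window s by simp
      also have "\<dots> \<le> lam * K * T" using s lamK(1) by (intro mult_left_mono) auto
      finally have "L - \<beta> / 4 \<le> g p s" using lamKT by simp
      then have "pi - \<alpha> - 3 / 4 * \<beta> \<le> (\<Theta> s a - c a) - (\<Theta> s b + c b)"
        by (simp add: g_def ab L_def)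
      moreover have "(\<Theta> s a - c a) - (\<Theta> s b + c b) \<le> pi - \<alpha> - \<beta> / 2"
        using below[OF \<open>0 \<le> s\<close> s(2) p(1)] by (simp add: g_def ab L_def)
      moreover have "(\<Theta> s a - c a) - \<Theta> s l \<le> pi - \<alpha> - \<beta> / 2
          \<and> \<Theta> s l - (\<Theta> s b + c b) \<le> pi - \<alpha> - \<beta> / 2" if "l \<in> {1..M}" for l
        using below[OF \<open>0 \<le> s\<close> s(2), of "(a, l)"] below[OF \<open>0 \<le> s\<close> s(2), of "(l, b)"] that ab \<open>M \<le> N\<close>
        by (simp add: g_def c_def[of l] L_def)
      ultimately have "(\<Sum>l = 1..N. sin (\<Theta> s l - (\<Theta> s a - c a)))
          - (\<Sum>l = 1..N. sin (\<Theta> s l - (\<Theta> s b + c b))) \<le> - 2 * \<mu> * real N"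
        using coupling_difference_le[OF N_pos \<open>M \<le> N\<close> \<open>0 < \<beta>\<close> \<open>\<beta> < \<alpha>\<close> \<open>2 * \<beta> + \<alpha> < pi\<close> \<mu>] by blast
      moreover have "sin (\<Theta> s l - (\<Theta> s a - c a)) = sin (\<Theta> s l - \<Theta> s a)"
        "sin (\<Theta> s l - (\<Theta> s b + c b)) = sin (\<Theta> s l - \<Theta> s b)" for l
        using sin_c(1)[of "\<Theta> s l - \<Theta> s a" a] sin_c(2)[of "\<Theta> s l - \<Theta> s b" b]
        by (simp_all add: algebra_simps)
      ultimately have "K / real N * ((\<Sum>l = 1..N. sin (\<Theta> s l - \<Theta> s a)) - (\<Sum>l = 1..N. sin (\<Theta> s l - \<Theta> s b)))
          \<le> K / real N * (- 2 * \<mu> * real N)"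
        using K_pos by (intro mult_left_mono) auto
      also have "\<dots> = - 2 * \<mu> * K" using N_pos by simp
      finally show ?thesis
        using vec_diam_ge[of a N b \<Omega>] ab \<Omega> by (simp add: force_def right_diff_distrib)
    qed
    \<comment> \<open>Relaxation towards \<open>- \<mu> * K\<close> over the whole window outweighs
      an initial gap of up to \<open>lam * K\<close>.\<close>
    have "\<Theta>' t a - \<Theta>' t b
        \<le> - \<mu> * K + exp (- (t - (t - T)) / m) * (\<Theta>' (t - T) a - \<Theta>' (t - T) b - - \<mu> * K)"
      using window drift ab \<open>0 < T\<close> by (intro velocity_gap_le) auto
    also have "exp (- (t - (t - T)) / m) = 1 / R" using exp_T by simp
    also have "1 / R * (\<Theta>' (t - T) a - \<Theta>' (t - T) b - - \<mu> * K) \<le> 1 / R * ((lam + \<mu>) * K)"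
      using window \<open>1 < R\<close> by (intro mult_left_mono) (auto simp: algebra_simps)
    also have "1 / R * ((lam + \<mu>) * K) < \<mu> * K"
    proof -
      have "lam + \<mu> < \<mu> * R" using \<open>0 < \<mu>\<close> by (simp add: R_def)
      then show ?thesis using K_pos \<open>1 < R\<close> by (simp add: pos_divide_less_eq mult_ac)
    qed
    finally have "\<Theta>' t a - \<Theta>' t b < 0" by simp
    moreover have "(g p has_real_derivative \<Theta>' t a - \<Theta>' t b) (at t)"
      unfolding g_def ab fst_conv snd_conv
      using phase_deriv[of a t] phase_deriv[of b t] ab \<open>0 < t\<close>
      by (auto intro!: derivative_eq_intros)
    ultimately show "\<exists>d<0. (g p has_real_derivative d) (at t)" by blast
  qed auto
  show ?thesis
  proof (rule that)
    fix t :: real and a b assume "0 \<le> t" "a \<in> {1..N}" "b \<in> {1..N}"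
    then have "g (a, b) t < L" using barrier by simp
    moreover have "c a \<le> 2 * real n * pi" "c b \<le> 2 * real n * pi" by (simp_all add: c_def)
    \<comment> \<open>Undoing both shifts costs at most \<open>2 * real n * pi\<close> each.\<close>
    ultimately show "\<Theta> t a - \<Theta> t b \<le> L + 2 * (2 * real n * pi)" by (simp add: g_def)
  qed
qed

end

theorem theorem1p1:
  fixes N M :: nat
    and m K \<alpha> \<beta> \<mu> lam :: real
    and \<Omega> :: "nat \<Rightarrow> real"
    and \<Theta> \<Theta>' :: "real \<Rightarrow> nat \<Rightarrow> real"
  assumes "0 < N" and "0 < m" and "0 < K"
    and "0 < M" and "real N / 2 < real M" and "M \<le> N"
    and "0 < \<beta>" and "\<beta> < \<alpha>" and "2 * \<beta> + \<alpha> < pi"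
    and "(real M / real N) * sin (\<alpha> / 2 - \<beta> / 4) * cos (\<alpha> / 2 + 5 / 8 * \<beta>)
           - (1 - real M / real N) * cos (\<alpha> / 2 - \<beta> / 8) > 0"
    and "0 < \<mu>"
    and "\<mu> \<le> (real M / real N) * sin (\<alpha> / 2 - \<beta> / 4) * cos (\<alpha> / 2 + 5 / 8 * \<beta>)
           - (1 - real M / real N) * cos (\<alpha> / 2 - \<beta> / 8)"
    and "lam > \<mu> + 2"
    and "m * K \<le> \<beta> / (4 * (lam + \<mu> + 2) * ln ((lam + 2 * \<mu> + 2) / \<mu>))"
    and "vec_diam N \<Omega> < \<mu> * K"
    and "inertial_kuramoto_solution N m K \<Omega> \<Theta> \<Theta>'"
    and "vec_diam M (\<Theta> 0) \<le> pi - \<alpha> - \<beta>"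
    and "vec_diam M (\<Theta>' 0) < lam * K"
  shows "\<forall>i\<in>{1..N}. ((\<lambda>t. \<Theta>' t i) \<longlongrightarrow> vec_mean N \<Omega>) at_top"
proof -
  interpret inertial_kuramoto N m K \<Omega> \<Theta> \<Theta>'
    using assms(1,2,3,16) by unfold_locales
  obtain B where "\<And>t a b. 0 \<le> t \<Longrightarrow> a \<in> {1..N} \<Longrightarrow> b \<in> {1..N} \<Longrightarrow> \<Theta> t a - \<Theta> t b \<le> B"
    using phases_bounded[OF assms(6-9,11-15,17-18)] by blast
  then show ?thesis using velocity_tendsto_mean by blast
qed

end
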